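(* $t(K(9,4))=\frac{5}{4}$. Moreover, if $S$ is a vertex cut of $K(9,4)$ such that $\frac{|S|}{c(K(9,4)\setminus S)} = \frac{5}{4}$, then $S$ is the complement of a maximum independent set of $K(9,4)$.
   Context: The Kneser graph $K(n,k)$ has as vertices the $k$-element subsets of $[n]=\{1,\dots,n\}$, two vertices being adjacent iff they are disjoint. A vertex cut is a set $S$ of vertices whose removal disconnects the graph; $c(G\setminus S)$ is the number of connected components after deleting $S$; the toughness is $t(G)=\min_S |S|/c(G\setminus S)$ over vertex cuts $S$. *)

theory Defs
  imports Complex_Main
begin

definition kneser_vertices :: "nat \<Rightarrow> nat \<Rightarrow> nat set set" where
  "kneser_vertices n k = {A. A \<subseteq> {1..n} \<and> card A = k}"

definition kneser_adj :: "nat set \<Rightarrow> nat set \<Rightarrow> bool" where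
  "kneser_adj A B \<longleftrightarrow> A \<inter> B = {}"

definition induced_edges :: "'a set \<Rightarrow> ('a \<Rightarrow> 'a \<Rightarrow> bool) \<Rightarrow> ('a \<times> 'a) set" where
  "induced_edges W E = {(x, y). x \<in> W \<and> y \<in> W \<and> E x y}"

definition components :: "'a set \<Rightarrow> ('a \<Rightarrow> 'a \<Rightarrow> bool) \<Rightarrow> 'a set set" where
  "components W E = (\<lambda>x. {y \<in> W. (x, y) \<in> (induced_edges W E)\<^sup>*}) ` W"

definition num_components :: "'a set \<Rightarrow> ('a \<Rightarrow> 'a \<Rightarrow> bool) \<Rightarrow> 'a set \<Rightarrow> nat" where
  "num_components V E S = card (components (V - S) E)"

definition is_vertex_cut :: "'a set \<Rightarrow> ('a \<Rightarrow> 'a \<Rightarrow> bool) \<Rightarrow> 'a set \<Rightarrow> bool" where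
  "is_vertex_cut V E S \<longleftrightarrow> S \<subseteq> V \<and> num_components V E S \<ge> 2"

definition toughness :: "'a set \<Rightarrow> ('a \<Rightarrow> 'a \<Rightarrow> bool) \<Rightarrow> real" where
  "toughness V E = Inf ((\<lambda>S. real (card S) / real (num_components V E S)) ` {S. is_vertex_cut V E S})"

definition independent_set :: "'a set \<Rightarrow> ('a \<Rightarrow> 'a \<Rightarrow> bool) \<Rightarrow> 'a set \<Rightarrow> bool" where
  "independent_set V E I \<longleftrightarrow> I \<subseteq> V \<and> (\<forall>x\<in>I. \<forall>y\<in>I. \<not> E x y)"

definition maximum_independent_set :: "'a set \<Rightarrow> ('a \<Rightarrow> 'a \<Rightarrow> bool) \<Rightarrow> 'a set \<Rightarrow> bool" where
  "maximum_independent_set V E I \<longleftrightarrow> independent_set V E I \<and>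
     (\<forall>J. independent_set V E J \<longrightarrow> card J \<le> card I)"

end

theory Submission
  imports Defs
begin

text \<open>
  The adjacency matrix \<open>A\<close> of \<open>K(9,4)\<close> has eigenvalues \<open>5, -4, 3, -2, 1\<close>, so \<open>A\<^sup>2 \<le> A + 20\<close>
  as quadratic forms. Evaluated at the indicator of \<open>S\<close>, with \<open>o(v)\<close> the number of neighbours
  of \<open>v\<close> in \<open>S\<close>, and using \<open>o(v)\<^sup>2 \<ge> o(v)\<close> for \<open>v\<close> in \<open>S\<close>, this says that the sum of
  \<open>o(v)\<^sup>2\<close> over \<open>v \<notin> S\<close> is at most \<open>20|S|\<close>. A component \<open>K\<close> contributes at least 25 to that sum,
  with equality only if it is a single vertex: the spectral gap gives at least
  \<open>|K|(126 - |K|)/63\<close> boundary edges, which suffices for \<open>7 \<le> |K| \<le> 111\<close>, and smaller sets are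
  handled by the absence of triangles and 4-cycles. Hence \<open>25c \<le> 20|S|\<close>. If some component has at
  least 112 vertices, the remaining 14 leave room for so few components that
  \<open>5c < 4|S|\<close> follows by counting neighbourhoods.
\<close>

section \<open>The spectrum of \<open>K(9,4)\<close>\<close>

abbreviation (input) VV :: "nat set set" where "VV \<equiv> kneser_vertices 9 4"

definition nbrs :: "nat set set \<Rightarrow> nat set \<Rightarrow> nat set set" where
  "nbrs S X = {Y \<in> S. X \<inter> Y = {}}"

text \<open>\<open>meet_op 0\<close> is the adjacency operator; the relations \<open>|X \<inter> Y| = 4, 0, 3, 1, 2\<close> are the distances
  \<open>0, 1, 2, 3, 4\<close> in the graph.\<close>

definition meet_op :: "nat \<Rightarrow> (nat set \<Rightarrow> real) \<Rightarrow> nat set \<Rightarrow> real" where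
  "meet_op j f X = (\<Sum>Y\<in>VV. of_bool (card (X \<inter> Y) = j) * f Y)"

section \<open>Neighbours of a vertex and intersection numbers\<close>

lemma finite_VV [simp]: "finite VV"
  by (simp add: kneser_vertices_def)

lemma card_VV [simp]: "card VV = 126"
  by (simp add: kneser_vertices_def n_subsets numeral_eq_Suc)

lemma VV_facts: "X \<in> VV \<Longrightarrow> X \<subseteq> {1..9} \<and> card X = 4 \<and> finite X"
  by (auto simp: kneser_vertices_def intro: finite_subset)

text \<open>Since \<open>X\<close> leaves five points, a neighbour is determined by the single point
  of the complement that it misses. Indexing neighbours by that point reduces counting them to
  counting points.\<close>

lemma nbrs_VV_eq:
  assumes "X \<in> VV"
  shows "nbrs VV X = (\<lambda>e. ({1..9} - X) - {e}) ` ({1..9} - X)"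
proof -
  have X: "X \<subseteq> {1..9}" "card X = 4" "finite X" using VV_facts[OF assms] by auto
  have W: "card ({1..9} - X) = 5" using X by (simp add: card_Diff_subset)
  show ?thesis
  proof (intro equalityI subsetI)
    fix Z assume "Z \<in> nbrs VV X"
    then have Z: "Z \<subseteq> {1..9} - X" "card Z = 4" "finite Z"
      using VV_facts[of Z] by (auto simp: nbrs_def)
    have "card (({1..9} - X) - Z) = 1"
      using Z W by (simp add: card_Diff_subset)
    then obtain e where "({1..9} - X) - Z = {e}" by (auto simp: card_1_singleton_iff)
    then have "e \<in> {1..9} - X" "Z = ({1..9} - X) - {e}" using Z by auto
    then show "Z \<in> (\<lambda>e. ({1..9} - X) - {e}) ` ({1..9} - X)" by blast
  next
    fix Z assume "Z \<in> (\<lambda>e. ({1..9} - X) - {e}) ` ({1..9} - X)"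
    then obtain e where e: "e \<in> {1..9} - X" "Z = ({1..9} - X) - {e}" by blast
    then have "card Z = 4" using W by (simp add: card_Diff_singleton)
    then show "Z \<in> nbrs VV X" using e by (auto simp: nbrs_def kneser_vertices_def)
  qed
qed

lemma inj_on_remove: "inj_on (\<lambda>e. W - {e}) W"
  by (auto simp: inj_on_def)

lemma card_nbrs_VV: "X \<in> VV \<Longrightarrow> card (nbrs VV X) = 5"
  using VV_facts[of X] by (simp add: nbrs_VV_eq card_image[OF inj_on_remove] card_Diff_subset)

text \<open>With \<open>W\<close> the complement of \<open>X\<close> and
  \<open>t = card (W \<inter> Y)\<close>, deleting one of the \<open>t\<close> points in
  \<open>Y\<close> leaves intersection \<open>t - 1\<close>, and deleting one of the other
  \<open>5 - t\<close> points leaves \<open>t\<close>. Expressed through \<open>j\<close>, these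
  counts are \<open>j + 1\<close> and \<open>5 - j\<close>; moreover \<open>t\<close> is 4 minus the
  size of \<open>X \<inter> Y\<close>.\<close>

lemma card_nbrs_meeting:
  assumes X: "X \<in> VV" and Y: "Y \<in> VV"
  shows "card {Z \<in> nbrs VV X. card (Z \<inter> Y) = j} =
    (j + 1) * of_bool (card (X \<inter> Y) + j = 3) + (5 - j) * of_bool (card (X \<inter> Y) + j = 4)"
proof -
  define W where "W = {1..9} - X"
  define t where "t = card (W \<inter> Y)"
  have XY: "X \<subseteq> {1..9}" "card X = 4" "finite X" "Y \<subseteq> {1..9}" "card Y = 4" "finite Y"
    using VV_facts[OF X] VV_facts[OF Y] by auto
  have W: "card W = 5" "finite W" unfolding W_def using XY by (simp_all add: card_Diff_subset)
  have "Y = (X \<inter> Y) \<union> (W \<inter> Y)" using XY by (auto simp: W_def)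
  then have "card Y = card (X \<inter> Y) + t" unfolding t_def
    by (metis (no_types, lifting) card_Un_disjoint finite_Int XY(3) W(2) W_def Diff_disjoint
        inf_assoc inf_bot_left inf_commute)
  then have st: "card (X \<inter> Y) + t = 4" using XY by simp
  have tW: "card (W - Y) = 5 - t" "t \<le> 4"
    using W st by (simp_all add: t_def card_Diff_subset_Int)
  have eY: "card ((W - {e}) \<inter> Y) = t - 1" if "e \<in> W \<inter> Y" for e
  proof -
    have "(W - {e}) \<inter> Y = (W \<inter> Y) - {e}" by auto
    then show ?thesis using that by (simp add: t_def)
  qed
  have eN: "card ((W - {e}) \<inter> Y) = t" if "e \<in> W - Y" for e
  proof -
    have "(W - {e}) \<inter> Y = W \<inter> Y" using that by auto
    then show ?thesis by (simp add: t_def)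
  qed
  have tpos: "t > 0" if "e \<in> W \<inter> Y" for e
    unfolding t_def using that W(2) by (auto simp: card_gt_0_iff)
  have "{Z \<in> nbrs VV X. card (Z \<inter> Y) = j} = (\<lambda>e. W - {e}) ` {e \<in> W. card ((W - {e}) \<inter> Y) = j}"
    unfolding nbrs_VV_eq[OF X] W_def[symmetric] by auto
  then have "card {Z \<in> nbrs VV X. card (Z \<inter> Y) = j} = card {e \<in> W. card ((W - {e}) \<inter> Y) = j}"
    by (simp add: card_image inj_on_subset[OF inj_on_remove])
  also have "{e \<in> W. card ((W - {e}) \<inter> Y) = j} =
      (if t = j + 1 then W \<inter> Y else {}) \<union> (if t = j then W - Y else {})"
    (is "?L = ?R")
  proof (rule set_eqI)
    fix e
    consider "e \<in> W \<inter> Y" | "e \<in> W - Y" | "e \<notin> W" by blast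
    then show "e \<in> ?L \<longleftrightarrow> e \<in> ?R"
    proof cases
      case 1
      then show ?thesis using eY[OF 1] tpos[OF 1] by auto
    next
      case 2
      then show ?thesis using eN[OF 2] by auto
    qed auto
  qed
  also have "card \<dots> = (j + 1) * of_bool (t = j + 1) + (5 - j) * of_bool (t = j)"
    using tW by (auto simp: t_def)
  also have "\<dots> = (j + 1) * of_bool (card (X \<inter> Y) + j = 3) + (5 - j) * of_bool (card (X \<inter> Y) + j = 4)"
    using st by (auto simp: of_bool_def)
  finally show ?thesis .
qed

lemma meet_op_0: "X \<in> VV \<Longrightarrow> meet_op 0 f X = (\<Sum>Y\<in>nbrs VV X. f Y)"
proof -
  assume "X \<in> VV"
  then have "meet_op 0 f X = (\<Sum>Y\<in>VV. if X \<inter> Y = {} then f Y else 0)"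
    unfolding meet_op_def using VV_facts[of X] by (intro sum.cong) auto
  then show ?thesis by (simp add: nbrs_def sum.inter_filter)
qed

lemma meet_op_4: "X \<in> VV \<Longrightarrow> meet_op 4 f X = f X"
proof -
  assume X: "X \<in> VV"
  have "card (X \<inter> Y) = 4 \<longleftrightarrow> Y = X" if "Y \<in> VV" for Y
  proof
    assume c: "card (X \<inter> Y) = 4"
    have "X \<inter> Y = X" by (rule card_subset_eq) (use VV_facts[OF X] c in auto)
    moreover have "X \<inter> Y = Y" by (rule card_subset_eq) (use VV_facts[OF that] c in auto)
    ultimately show "Y = X" by simp
  qed (use VV_facts[OF X] in auto)
  then have "meet_op 4 f X = (\<Sum>Y\<in>VV. if Y = X then f Y else 0)"
    unfolding meet_op_def by (intro sum.cong) auto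
  then show ?thesis using X by simp
qed

text \<open>Interchanging the sums leaves, for each \<open>Y\<close>, the number of neighbours of
  \<open>X\<close> meeting \<open>Y\<close> in \<open>j\<close> points. The bound on
  \<open>j\<close> keeps the natural subtraction \<open>3 - j\<close> from truncating.\<close>

lemma meet_op_0_meet_op:
  assumes X: "X \<in> VV" and j: "j \<le> 3"
  shows "meet_op 0 (meet_op j f) X = (real j + 1) * meet_op (3 - j) f X + (5 - real j) * meet_op (4 - j) f X"
proof -
  have "meet_op 0 (meet_op j f) X = (\<Sum>Z\<in>nbrs VV X. \<Sum>Y\<in>VV. of_bool (card (Z \<inter> Y) = j) * f Y)"
    unfolding meet_op_0[OF X] unfolding meet_op_def ..
  also have "\<dots> = (\<Sum>Y\<in>VV. \<Sum>Z\<in>nbrs VV X. of_bool (card (Z \<inter> Y) = j) * f Y)"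
    by (rule sum.swap)
  also have "\<dots> = (\<Sum>Y\<in>VV. real (card {Z \<in> nbrs VV X. card (Z \<inter> Y) = j}) * f Y)"
  proof (rule sum.cong[OF refl])
    fix Y
    have "finite (nbrs VV X)" by (simp add: nbrs_def)
    then show "(\<Sum>Z\<in>nbrs VV X. of_bool (card (Z \<inter> Y) = j) * f Y) =
        real (card {Z \<in> nbrs VV X. card (Z \<inter> Y) = j}) * f Y"
      by (simp add: sum_distrib_right[symmetric] Int_def)
  qed
  also have "\<dots> = (\<Sum>Y\<in>VV. (real j + 1) * (of_bool (card (X \<inter> Y) = 3 - j) * f Y)
      + (5 - real j) * (of_bool (card (X \<inter> Y) = 4 - j) * f Y))"
  proof (rule sum.cong[OF refl])
    fix Y assume Y: "Y \<in> VV"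
    have "(card (X \<inter> Y) + j = 3) = (card (X \<inter> Y) = 3 - j)" "(card (X \<inter> Y) + j = 4) = (card (X \<inter> Y) = 4 - j)"
      using j by auto
    moreover have "real (5 - j) = 5 - real j" using j by simp
    ultimately show "real (card {Z \<in> nbrs VV X. card (Z \<inter> Y) = j}) * f Y =
       (real j + 1) * (of_bool (card (X \<inter> Y) = 3 - j) * f Y)
      + (5 - real j) * (of_bool (card (X \<inter> Y) = 4 - j) * f Y)"
      unfolding card_nbrs_meeting[OF X Y] by (simp add: algebra_simps)
  qed
  also have "\<dots> = (real j + 1) * meet_op (3 - j) f X + (5 - real j) * meet_op (4 - j) f X"
    by (simp add: meet_op_def sum.distrib sum_distrib_left del: sum_of_bool_mult_eq)
  finally show ?thesis .
qed

lemma sum_meet_op: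
  assumes "X \<in> VV"
  shows "meet_op 0 f X + meet_op 1 f X + meet_op 2 f X + meet_op 3 f X + meet_op 4 f X = sum f VV"
proof -
  have "of_bool (card (X \<inter> Y) = 0) * f Y + of_bool (card (X \<inter> Y) = 1) * f Y + of_bool (card (X \<inter> Y) = 2) * f Y
    + of_bool (card (X \<inter> Y) = 3) * f Y + of_bool (card (X \<inter> Y) = 4) * f Y = f Y" if "Y \<in> VV" for Y
  proof -
    have "card (X \<inter> Y) \<le> 4" using VV_facts[OF assms] card_mono[of X "X \<inter> Y"] by auto
    then have "card (X \<inter> Y) \<in> {0,1,2,3,4}" by auto
    then show ?thesis by auto
  qed
  then show ?thesis unfolding meet_op_def sum.distrib[symmetric] by (intro sum.cong) auto
qed

section \<open>Linearity, self-adjointness and the spectral decomposition\<close>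

lemma meet_op_cong: "(\<And>Y. Y \<in> VV \<Longrightarrow> f Y = g Y) \<Longrightarrow> meet_op j f X = meet_op j g X"
  unfolding meet_op_def by (intro sum.cong) auto

lemma meet_op_add: "meet_op j (\<lambda>Y. f Y + g Y) X = meet_op j f X + meet_op j g X"
  by (simp add: meet_op_def sum.distrib algebra_simps)

lemma meet_op_diff: "meet_op j (\<lambda>Y. f Y - g Y) X = meet_op j f X - meet_op j g X"
  by (simp add: meet_op_def sum_subtractf algebra_simps)

lemma meet_op_scale: "meet_op j (\<lambda>Y. c * f Y) X = c * meet_op j f X"
  by (simp add: meet_op_def sum_distrib_left mult.left_commute del: sum_of_bool_mult_eq)

lemma meet_op_divide: "meet_op j (\<lambda>Y. f Y / c) X = meet_op j f X / c"
  by (simp add: meet_op_def sum_divide_distrib del: sum_of_bool_mult_eq)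

lemmas meet_op_linear = meet_op_add meet_op_diff meet_op_scale meet_op_divide

lemma meet_op_selfadjoint:
  "(\<Sum>X\<in>VV. meet_op j f X * g X) = (\<Sum>X\<in>VV. f X * meet_op j g X)"
proof -
  have "(\<Sum>X\<in>VV. meet_op j f X * g X) = (\<Sum>X\<in>VV. \<Sum>Y\<in>VV. of_bool (card (X \<inter> Y) = j) * f Y * g X)"
    unfolding meet_op_def sum_distrib_right ..
  also have "\<dots> = (\<Sum>Y\<in>VV. \<Sum>X\<in>VV. of_bool (card (X \<inter> Y) = j) * f Y * g X)"
    by (rule sum.swap)
  also have "\<dots> = (\<Sum>X\<in>VV. f X * meet_op j g X)"
    unfolding meet_op_def sum_distrib_left by (intro sum.cong) (auto simp: Int_commute)
  finally show ?thesis .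
qed

text \<open>The first identity says that the adjacency operator is annihilated by the quintic with
  roots 5, 1, -2, 3, -4. The second uses its factor without the root 5, which is 504 at 5: applied
  to the operator it gives 504/126 = 4 times the all-ones matrix. Both follow by expressing the
  iterates through the operators \<open>meet_op j\<close> and eliminating the latter.\<close>

lemma meet_op_powers:
  fixes f :: "nat set \<Rightarrow> real"
  defines "x1 \<equiv> meet_op 0 f"
  defines "x2 \<equiv> meet_op 0 x1"
  defines "x3 \<equiv> meet_op 0 x2"
  defines "x4 \<equiv> meet_op 0 x3"
  defines "x5 \<equiv> meet_op 0 x4"
  assumes X: "X \<in> VV"
  shows "x5 X = 3 * x4 X + 23 * x3 X - 51 * x2 X - 94 * x1 X + 120 * f X"
    and "x4 X + 2 * x3 X - 13 * x2 X - 14 * x1 X + 24 * f X = 4 * sum f VV"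
proof -
  have r0: "x2 X = meet_op 3 f X + 5 * f X" if "X \<in> VV" for X
    using meet_op_0_meet_op[OF that, of 0 f] meet_op_4[OF that, of f] by (simp add: x2_def x1_def)
  have r3: "meet_op 0 (meet_op 3 f) X = 4 * x1 X + 2 * meet_op 1 f X" if "X \<in> VV" for X
    using meet_op_0_meet_op[OF that, of 3 f] by (simp add: x1_def)
  have r1: "meet_op 0 (meet_op 1 f) X = 2 * meet_op 2 f X + 4 * meet_op 3 f X" if "X \<in> VV" for X
    using meet_op_0_meet_op[OF that, of 1 f] by (simp add: numeral_eq_Suc)
  have r2: "meet_op 0 (meet_op 2 f) X = 3 * meet_op 1 f X + 3 * meet_op 2 f X" if "X \<in> VV" for X
    using meet_op_0_meet_op[OF that, of 2 f] by simp
  have x3: "x3 X = 9 * x1 X + 2 * meet_op 1 f X" if "X \<in> VV" for X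
  proof -
    have "x3 X = meet_op 0 (\<lambda>X. meet_op 3 f X + 5 * f X) X"
      unfolding x3_def by (rule meet_op_cong) (rule r0)
    then show ?thesis using r3[OF that] by (simp add: meet_op_linear x1_def)
  qed
  have x4: "x4 X = 9 * x2 X + 4 * meet_op 2 f X + 8 * meet_op 3 f X" if "X \<in> VV" for X
  proof -
    have "x4 X = meet_op 0 (\<lambda>X. 9 * x1 X + 2 * meet_op 1 f X) X"
      unfolding x4_def by (rule meet_op_cong) (rule x3)
    then show ?thesis using r1[OF that] by (simp add: meet_op_linear x2_def)
  qed
  have x5: "x5 X = 9 * x3 X + 4 * (3 * meet_op 1 f X + 3 * meet_op 2 f X) + 8 * (4 * x1 X + 2 * meet_op 1 f X)"
    if "X \<in> VV" for X
  proof -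
    have "x5 X = meet_op 0 (\<lambda>X. 9 * x2 X + 4 * meet_op 2 f X + 8 * meet_op 3 f X) X"
      unfolding x5_def by (rule meet_op_cong) (rule x4)
    then show ?thesis using r2[OF that] r3[OF that] by (simp add: meet_op_linear x3_def)
  qed
  show "x5 X = 3 * x4 X + 23 * x3 X - 51 * x2 X - 94 * x1 X + 120 * f X"
    using x5[OF X] x4[OF X] x3[OF X] r0[OF X] by (simp add: algebra_simps)
  have "x1 X + meet_op 1 f X + meet_op 2 f X + meet_op 3 f X + f X = sum f VV"
    using sum_meet_op[OF X, of f] meet_op_4[OF X, of f] by (simp add: x1_def)
  then show "x4 X + 2 * x3 X - 13 * x2 X - 14 * x1 X + 24 * f X = 4 * sum f VV"
    using x4[OF X] x3[OF X] r0[OF X] by linarith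
qed

text \<open>Self-adjointness makes eigenvectors for different eigenvalues orthogonal, so only the
  diagonal terms of the double sum survive.\<close>

lemma eigen_sum_inner:
  fixes x :: "real \<Rightarrow> nat set \<Rightarrow> real"
  assumes E: "finite E"
    and eig: "\<And>t X. t \<in> E \<Longrightarrow> X \<in> VV \<Longrightarrow> meet_op 0 (x t) X = t * x t X"
  shows "(\<Sum>X\<in>VV. (\<Sum>t\<in>E. a t * x t X) * (\<Sum>t\<in>E. b t * x t X))
    = (\<Sum>t\<in>E. a t * b t * (\<Sum>X\<in>VV. (x t X)\<^sup>2))"
proof -
  have orth: "(\<Sum>X\<in>VV. x s X * x t X) = (if s = t then (\<Sum>X\<in>VV. (x t X)\<^sup>2) else 0)"
    if "s \<in> E" "t \<in> E" for s t
  proof (cases "s = t")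
    case False
    have "s * (\<Sum>X\<in>VV. x s X * x t X) = (\<Sum>X\<in>VV. meet_op 0 (x s) X * x t X)"
      using eig[OF that(1)] by (simp add: sum_distrib_left mult.assoc)
    also have "\<dots> = t * (\<Sum>X\<in>VV. x s X * x t X)"
      unfolding meet_op_selfadjoint using eig[OF that(2)] by (simp add: sum_distrib_left algebra_simps)
    finally show ?thesis using False by simp
  qed (simp add: power2_eq_square)
  have "(\<Sum>X\<in>VV. (\<Sum>t\<in>E. a t * x t X) * (\<Sum>t\<in>E. b t * x t X))
     = (\<Sum>X\<in>VV. \<Sum>s\<in>E. \<Sum>t\<in>E. a s * b t * (x s X * x t X))"
    by (simp add: sum_product algebra_simps)
  also have "\<dots> = (\<Sum>s\<in>E. \<Sum>X\<in>VV. \<Sum>t\<in>E. a s * b t * (x s X * x t X))"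
    by (rule sum.swap)
  also have "\<dots> = (\<Sum>s\<in>E. \<Sum>t\<in>E. \<Sum>X\<in>VV. a s * b t * (x s X * x t X))"
    by (intro sum.cong refl sum.swap)
  also have "\<dots> = (\<Sum>s\<in>E. \<Sum>t\<in>E. if s = t then a s * b t * (\<Sum>X\<in>VV. (x t X)\<^sup>2) else 0)"
    by (intro sum.cong refl) (simp add: sum_distrib_left[symmetric] orth)
  also have "\<dots> = (\<Sum>t\<in>E. a t * b t * (\<Sum>X\<in>VV. (x t X)\<^sup>2))"
    using E by simp
  finally show ?thesis .
qed

text \<open>\<open>n1\<close>, \<open>n2\<close>, \<open>n3\<close>, \<open>n4\<close> are the
  squared norms of the projections of \<open>f\<close> to the eigenspaces of 1, -2, 3, -4. The
  projection to the eigenvalue 5 is the mean of \<open>f\<close>, which accounts for the explicit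
  term. The three quadratic forms weight these norms by 1, t and t^2.\<close>

lemma spectral_decomposition:
  fixes f :: "nat set \<Rightarrow> real"
  obtains n1 n2 n3 n4 :: real
  where "n1 \<ge> 0" "n2 \<ge> 0" "n3 \<ge> 0" "n4 \<ge> 0"
    "(\<Sum>X\<in>VV. (f X)\<^sup>2) = (sum f VV)\<^sup>2 / 126 + n1 + n2 + n3 + n4"
    "(\<Sum>X\<in>VV. f X * meet_op 0 f X) = 5 * ((sum f VV)\<^sup>2 / 126) + n1 - 2 * n2 + 3 * n3 - 4 * n4"
    "(\<Sum>X\<in>VV. (meet_op 0 f X)\<^sup>2) = 25 * ((sum f VV)\<^sup>2 / 126) + n1 + 4 * n2 + 9 * n3 + 16 * n4"
proof -
  define x1 where "x1 = meet_op 0 f"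
  define x2 where "x2 = meet_op 0 x1"
  define x3 where "x3 = meet_op 0 x2"
  define x4 where "x4 = meet_op 0 x3"
  define x5 where "x5 = meet_op 0 x4"
  note defs = x1_def x2_def x3_def x4_def x5_def
  have rel: "x5 X = 3 * x4 X + 23 * x3 X - 51 * x2 X - 94 * x1 X + 120 * f X" if "X \<in> VV" for X
    using meet_op_powers(1)[OF that, of f] by (simp add: defs)
  have J: "x4 X + 2 * x3 X - 13 * x2 X - 14 * x1 X + 24 * f X = 4 * sum f VV" if "X \<in> VV" for X
    using meet_op_powers(2)[OF that, of f] by (simp add: defs)
  \<comment> \<open>\<open>y t\<close> is the Lagrange interpolation polynomial at \<open>t\<close> with nodes \<open>E\<close>, evaluated at the
    adjacency operator and applied to \<open>f\<close>: the projection of \<open>f\<close> to the eigenspace of \<open>t\<close>.\<close>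
  define E :: "real set" where "E = {5, 1, -2, 3, -4}"
  define y where "y t X =
     (if t = 5 then (x4 X + 2 * x3 X - 13 * x2 X - 14 * x1 X + 24 * f X) / 504
      else if t = 1 then (x4 X - 2 * x3 X - 25 * x2 X + 26 * x1 X + 120 * f X) / 120
      else if t = -2 then (5 * x3 X - x4 X + 13 * x2 X - 77 * x1 X + 60 * f X) / 210
      else if t = 3 then (23 * x2 X - x4 X + 18 * x1 X - 40 * f X) / 140
      else (x4 X - 7 * x3 X + 5 * x2 X + 31 * x1 X - 30 * f X) / 630)" for t :: real and X
  \<comment> \<open>Multiplying the interpolation polynomial at \<open>t\<close> by the missing
    linear factor gives a multiple of the quintic in \<open>rel\<close>, which vanishes.\<close>
  have eig: "meet_op 0 (y t) X = t * y t X" if "t \<in> E" "X \<in> VV" for t X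
    using that(1) rel[OF that(2)] unfolding E_def
    by (auto simp: y_def[abs_def] meet_op_linear simp flip: defs)
  have f: "(\<Sum>t\<in>E. 1 * y t X) = f X" if "X \<in> VV" for X
    by (simp add: E_def y_def field_simps)
  have f1: "(\<Sum>t\<in>E. t * y t X) = meet_op 0 f X" if "X \<in> VV" for X
    using rel[OF that] unfolding x1_def[symmetric] by (simp add: E_def y_def field_simps)
  \<comment> \<open>By \<open>J\<close>, \<open>y 5\<close> is constant with value 4/504 = 1/126
    times the sum of \<open>f\<close>.\<close>
  have n5: "(\<Sum>X\<in>VV. (y 5 X)\<^sup>2) = (sum f VV)\<^sup>2 / 126"
    by (simp add: y_def J power_divide power_mult_distrib)
  define n where "n t = (\<Sum>X\<in>VV. (y t X)\<^sup>2)" for t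
  have n0: "n t \<ge> 0" for t by (simp add: n_def sum_nonneg)
  have E: "finite E" by (simp add: E_def)
  note inner = eigen_sum_inner[OF E eig, folded n_def]
  have "(\<Sum>X\<in>VV. (f X)\<^sup>2) = (\<Sum>t\<in>E. n t)"
    using inner[of "\<lambda>_. 1" "\<lambda>_. 1"] f by (simp add: power2_eq_square)
  moreover have "(\<Sum>X\<in>VV. f X * meet_op 0 f X) = (\<Sum>t\<in>E. t * n t)"
    using inner[of "\<lambda>_. 1" "\<lambda>t. t"] f f1 by simp
  moreover have "(\<Sum>X\<in>VV. (meet_op 0 f X)\<^sup>2) = (\<Sum>t\<in>E. t * t * n t)"
    using inner[of "\<lambda>t. t" "\<lambda>t. t"] f1 by (simp add: power2_eq_square)
  ultimately show ?thesis
    using that[of "n 1" "n (-2)" "n 3" "n (-4)"] n0 n5 by (simp add: E_def n_def)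
qed

section \<open>Edge boundaries\<close>

lemma finite_nbrs: "S \<subseteq> VV \<Longrightarrow> finite (nbrs S X)"
  by (rule finite_subset[of _ VV]) (auto simp: nbrs_def)

lemma meet_op_0_indicator:
  assumes "S \<subseteq> VV" "X \<in> VV"
  shows "meet_op 0 (\<lambda>Y. of_bool (Y \<in> S)) X = card (nbrs S X)"
proof -
  have "nbrs VV X \<inter> S = nbrs S X" using assms by (auto simp: nbrs_def)
  then show ?thesis using assms finite_nbrs[of VV X] by (simp add: meet_op_0)
qed

lemma sum_indicator_mult:
  fixes g :: "nat set \<Rightarrow> real"
  assumes "S \<subseteq> VV"
  shows "(\<Sum>X\<in>VV. of_bool (X \<in> S) * g X) = sum g S"
  using assms by (simp add: Int_absorb1)

lemma sum_nbrs_squared_outside: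
  assumes S: "S \<subseteq> VV"
  shows "(\<Sum>X\<in>VV - S. (card (nbrs S X))\<^sup>2) \<le> 20 * card S"
proof -
  define f :: "nat set \<Rightarrow> real" where "f = (\<lambda>Y. of_bool (Y \<in> S))"
  define o' where "o' X = real (card (nbrs S X))" for X
  obtain n1 n2 n3 n4 where n: "n1 \<ge> 0" "n2 \<ge> 0" "n3 \<ge> 0" "n4 \<ge> 0"
    "(\<Sum>X\<in>VV. (f X)\<^sup>2) = (sum f VV)\<^sup>2 / 126 + n1 + n2 + n3 + n4"
    "(\<Sum>X\<in>VV. f X * meet_op 0 f X) = 5 * ((sum f VV)\<^sup>2 / 126) + n1 - 2 * n2 + 3 * n3 - 4 * n4"
    "(\<Sum>X\<in>VV. (meet_op 0 f X)\<^sup>2) = 25 * ((sum f VV)\<^sup>2 / 126) + n1 + 4 * n2 + 9 * n3 + 16 * n4"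
    using spectral_decomposition .
  have Af: "meet_op 0 f X = o' X" if "X \<in> VV" for X
    using meet_op_0_indicator[OF S that] by (simp add: f_def o'_def)
  have 1: "(\<Sum>X\<in>VV. (f X)\<^sup>2) = card S"
    using sum_indicator_mult[OF S, of "\<lambda>_. 1"] by (simp add: f_def power2_eq_square)
  have 2: "(\<Sum>X\<in>VV. f X * meet_op 0 f X) = sum o' S"
    using sum_indicator_mult[OF S, of "meet_op 0 f"] S Af by (simp add: f_def subset_eq)
  have 3: "(\<Sum>X\<in>VV. (meet_op 0 f X)\<^sup>2) = (\<Sum>X\<in>VV - S. (o' X)\<^sup>2) + (\<Sum>X\<in>S. (o' X)\<^sup>2)"
    using S by (simp add: Af sum.subset_diff[OF S])
  have 4: "sum o' S \<le> (\<Sum>X\<in>S. (o' X)\<^sup>2)"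
  proof (rule sum_mono)
    fix X
    have "card (nbrs S X) \<le> (card (nbrs S X))\<^sup>2" by (simp add: power2_eq_square)
    then show "o' X \<le> (o' X)\<^sup>2" unfolding o'_def by (metis of_nat_le_iff of_nat_power)
  qed
  \<comment> \<open>The polynomial t^2 - t - 20 = (t - 5)(t + 4) is nonpositive at all five
    eigenvalues; fact 4 then cancels the contribution of \<open>S\<close>.\<close>
  have "(\<Sum>X\<in>VV - S. (o' X)\<^sup>2) \<le> 20 * card S"
    using n 1 2 3 4 by linarith
  then have "real (\<Sum>X\<in>VV - S. (card (nbrs S X))\<^sup>2) \<le> real (20 * card S)"
    by (simp add: o'_def)
  then show ?thesis by (simp only: of_nat_le_iff)
qed

lemma card_nbrs_split:
  assumes "K \<subseteq> VV" "X \<in> VV"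
  shows "card (nbrs K X) + card (nbrs (VV - K) X) = 5"
proof -
  have "nbrs VV X = nbrs K X \<union> nbrs (VV - K) X" "nbrs K X \<inter> nbrs (VV - K) X = {}"
    using assms by (auto simp: nbrs_def)
  then show ?thesis
    using card_nbrs_VV[OF assms(2)] finite_nbrs[OF assms(1)] finite_nbrs[of "VV - K"]
    by (metis Diff_subset card_Un_disjoint)
qed

text \<open>All eigenvalues but 5 are at most 3. Applied to the indicator of \<open>K\<close>, this
  gap of 2 forces at least \<open>2 * card K * (126 - card K) / 126\<close> boundary edges.\<close>

lemma edge_boundary_lower_bound:
  assumes K: "K \<subseteq> VV"
  shows "card K * (126 - card K) \<le> 63 * (\<Sum>X\<in>K. card (nbrs (VV - K) X))"
proof -
  define f :: "nat set \<Rightarrow> real" where "f = (\<lambda>Y. of_bool (Y \<in> K))"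
  obtain n1 n2 n3 n4 where n: "n1 \<ge> 0" "n2 \<ge> 0" "n3 \<ge> 0" "n4 \<ge> 0"
    "(\<Sum>X\<in>VV. (f X)\<^sup>2) = (sum f VV)\<^sup>2 / 126 + n1 + n2 + n3 + n4"
    "(\<Sum>X\<in>VV. f X * meet_op 0 f X) = 5 * ((sum f VV)\<^sup>2 / 126) + n1 - 2 * n2 + 3 * n3 - 4 * n4"
    using spectral_decomposition .
  have cK: "card K \<le> 126" using card_mono[OF finite_VV K] by simp
  have Af: "meet_op 0 f X = real (card (nbrs K X))" if "X \<in> VV" for X
    using meet_op_0_indicator[OF K that] by (simp add: f_def)
  have 0: "sum f VV = card K"
    using sum_indicator_mult[OF K, of "\<lambda>_. 1"] by (simp add: f_def)
  have 1: "(\<Sum>X\<in>VV. (f X)\<^sup>2) = card K"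
    using sum_indicator_mult[OF K, of "\<lambda>_. 1"] by (simp add: f_def power2_eq_square)
  have "(\<Sum>X\<in>VV. f X * meet_op 0 f X) = (\<Sum>X\<in>K. real (card (nbrs K X)))"
    using sum_indicator_mult[OF K, of "meet_op 0 f"] K Af by (simp add: f_def subset_eq)
  also have "\<dots> = (\<Sum>X\<in>K. 5 - real (card (nbrs (VV - K) X)))"
  proof (rule sum.cong[OF refl])
    fix X assume "X \<in> K"
    then show "real (card (nbrs K X)) = 5 - real (card (nbrs (VV - K) X))"
      using card_nbrs_split[OF K, of X] K by auto
  qed
  also have "\<dots> = 5 * card K - real (\<Sum>X\<in>K. card (nbrs (VV - K) X))"
    by (simp add: sum_subtractf)
  finally have "real (card K) * (126 - real (card K)) \<le> 63 * real (\<Sum>X\<in>K. card (nbrs (VV - K) X))"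
    using n 0 1 by (simp add: power2_eq_square algebra_simps)
  moreover have "real (card K) * (126 - real (card K)) = real (card K * (126 - card K))"
    using cK by simp
  ultimately have "real (card K * (126 - card K)) \<le> real (63 * (\<Sum>X\<in>K. card (nbrs (VV - K) X)))"
    by simp
  then show ?thesis by (simp only: of_nat_le_iff)
qed

section \<open>Absence of triangles and 4-cycles\<close>

lemma nbrs_VV_disjoint:
  assumes "X \<in> VV" "Y \<in> VV" "X \<inter> Y = {}"
  shows "nbrs VV X \<inter> nbrs VV Y = {}"
proof (rule ccontr)
  assume "nbrs VV X \<inter> nbrs VV Y \<noteq> {}"
  then obtain Z where Z: "Z \<in> VV" "X \<inter> Z = {}" "Y \<inter> Z = {}" by (auto simp: nbrs_def)
  \<comment> \<open>A triangle would be three pairwise disjoint 4-sets among nine points.\<close>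
  have "card (X \<union> Y \<union> Z) = 12"
    using assms Z VV_facts[of X] VV_facts[of Y] VV_facts[of Z] by (simp add: card_Un_disjoint Int_Un_distrib2)
  moreover have "card (X \<union> Y \<union> Z) \<le> card {1..9::nat}"
    using assms Z VV_facts[of X] VV_facts[of Y] VV_facts[of Z] by (intro card_mono) auto
  ultimately show False by simp
qed

text \<open>Two different 4-sets cover at least five points, leaving at most four for a common
  neighbour, so there is at most one choice.\<close>

lemma card_common_nbrs:
  assumes "X \<in> VV" "Y \<in> VV" "X \<noteq> Y"
  shows "card (nbrs VV X \<inter> nbrs VV Y) \<le> 1"
proof -
  have X: "X \<subseteq> {1..9}" "card X = 4" "finite X" and Y: "Y \<subseteq> {1..9}" "card Y = 4" "finite Y"
    using VV_facts assms by auto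
  have "X \<subset> X \<union> Y" using assms(3) X Y by (metis card_subset_eq inf_sup_ord(3) psubsetI sup_commute)
  then have "card (X \<union> Y) > 4" using psubset_card_mono[of "X \<union> Y" X] X Y by simp
  then have c: "card ({1..9} - (X \<union> Y)) \<le> 4" using X Y by (simp add: card_Diff_subset)
  have "nbrs VV X \<inter> nbrs VV Y \<subseteq> {{1..9} - (X \<union> Y)}"
  proof
    fix Z assume Z: "Z \<in> nbrs VV X \<inter> nbrs VV Y"
    then have "Z \<subseteq> {1..9} - (X \<union> Y)" "card Z = 4" using VV_facts[of Z] by (auto simp: nbrs_def)
    then have "Z = {1..9} - (X \<union> Y)" using c card_seteq[of "{1..9} - (X \<union> Y)" Z] by simp
    then show "Z \<in> {{1..9} - (X \<union> Y)}" by simp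
  qed
  then have "card (nbrs VV X \<inter> nbrs VV Y) \<le> card {{1..9} - (X \<union> Y)}" by (intro card_mono) auto
  then show ?thesis by simp
qed

lemma nbrs_mono: "K \<subseteq> L \<Longrightarrow> nbrs K X \<subseteq> nbrs L X"
  by (auto simp: nbrs_def)

lemma card_nbrs_Un:
  assumes "K \<subseteq> VV" "X \<in> VV" "Y \<in> VV" "X \<noteq> Y"
  shows "card (nbrs K X) + card (nbrs K Y) \<le> card (nbrs K X \<union> nbrs K Y) + 1"
proof -
  have "card (nbrs K X \<inter> nbrs K Y) \<le> card (nbrs VV X \<inter> nbrs VV Y)"
    using nbrs_mono[OF assms(1)] finite_nbrs[of VV] by (intro card_mono) blast+
  then show ?thesis
    using card_common_nbrs[OF assms(2-4)] card_Un_Int[OF finite_nbrs[OF assms(1)] finite_nbrs[OF assms(1)], of X Y]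
    by simp
qed

lemma card_nbrs_Un3:
  assumes "X \<in> VV" "Y \<in> VV" "Z \<in> VV" "X \<noteq> Y" "X \<noteq> Z" "Y \<noteq> Z"
  shows "card (nbrs VV X \<union> nbrs VV Y \<union> nbrs VV Z) \<ge> 12"
proof -
  let ?N = "nbrs VV"
  have fin: "finite (?N A)" for A by (rule finite_nbrs) simp
  have "card (?N X \<union> ?N Y) \<ge> 9"
    using card_nbrs_Un[of VV X Y] card_nbrs_VV assms by simp
  moreover have "card ((?N X \<union> ?N Y) \<inter> ?N Z) \<le> 2"
  proof -
    have "(?N X \<union> ?N Y) \<inter> ?N Z = (?N X \<inter> ?N Z) \<union> (?N Y \<inter> ?N Z)" by blast
    then show ?thesis
      using card_Un_le[of "?N X \<inter> ?N Z" "?N Y \<inter> ?N Z"] card_common_nbrs[of X Z] card_common_nbrs[of Y Z] assms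
      by simp
  qed
  ultimately show ?thesis
    using card_Un_Int[of "?N X \<union> ?N Y" "?N Z"] fin card_nbrs_VV[of Z] assms by simp
qed

section \<open>Sums of squared boundary degrees\<close>

lemma boundary_squares_large:
  assumes K: "K \<subseteq> VV" and m: "7 \<le> card K" "card K \<le> 111"
  shows "25 < (\<Sum>X\<in>K. (card (nbrs (VV - K) X))\<^sup>2)"
proof -
  define m where "m = card K"
  define e where "e = (\<Sum>X\<in>K. card (nbrs (VV - K) X))"
  define g where "g = (\<Sum>X\<in>K. (card (nbrs (VV - K) X))\<^sup>2)"
  have e: "m * (126 - m) \<le> 63 * e" using edge_boundary_lower_bound[OF K] by (simp add: e_def m_def)
  \<comment> \<open>This is the tangent to the square at 2: for small \<open>K\<close> the spectral
    bound guarantees slightly less than two boundary edges per vertex.\<close>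
  have "4 * a \<le> a\<^sup>2 + 4" for a :: nat
  proof -
    have "0 \<le> (int a - 2)\<^sup>2" by simp
    then have "int (4 * a) \<le> int (a\<^sup>2 + 4)" by (simp add: power2_diff)
    then show ?thesis by (simp only: of_nat_le_iff)
  qed
  then have "(\<Sum>X\<in>K. 4 * card (nbrs (VV - K) X)) \<le> (\<Sum>X\<in>K. (card (nbrs (VV - K) X))\<^sup>2 + 4)"
    by (rule sum_mono)
  then have g4: "4 * e \<le> g + 4 * m"
    by (simp add: e_def g_def m_def sum.distrib sum_distrib_left)
  have g1: "e \<le> g" unfolding e_def g_def by (rule sum_mono) (simp add: power2_eq_square)
  have "25 < g"
  proof (cases "m \<le> 14")
    case True
    then have "m \<in> {7,8,9,10,11,12,13,14}" using m unfolding m_def by auto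
    \<comment> \<open>Integrality of \<open>e\<close> matters: for \<open>m = 7\<close> the bound
      833/63 rounds up to 14, giving \<open>g \<ge> 28\<close>, while without rounding the estimate
      stays below 25.\<close>
    then show ?thesis using e g4 by auto presburger
  next
    case False
    \<comment> \<open>Between 15 and 111 the product \<open>m * (126 - m)\<close> is at least 15 *
      111 = 1665, so there are more than 26 boundary edges and \<open>e \<le> g\<close>
      suffices.\<close>
    then have "0 \<le> (int m - 15) * (111 - int m)" using m unfolding m_def by simp
    moreover have "int m * (126 - int m) = int (m * (126 - m))" using m unfolding m_def by simp
    ultimately have "1665 \<le> int (m * (126 - m))" by (simp add: algebra_simps)
    then have "1665 \<le> m * (126 - m)" by linarith
    then show ?thesis using e g1 by linarith
  qed
  then show ?thesis by (simp add: g_def)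
qed

lemma boundary_squares_small:
  assumes K: "K \<subseteq> VV" and m: "2 \<le> card K" "card K \<le> 6"
  shows "25 < (\<Sum>X\<in>K. (card (nbrs (VV - K) X))\<^sup>2)"
proof -
  have fK: "finite K" using K by (rule finite_subset) simp
  \<comment> \<open>Outside \<open>H\<close> every vertex contributes at least 9, so three such vertices suffice.\<close>
  define H where "H = {X \<in> K. card (nbrs K X) \<ge> 3}"
  have HK: "H \<subseteq> K" "finite H" using fK by (auto simp: H_def)
  have self: "X \<notin> nbrs L X" if "X \<in> VV" for X L using VV_facts[OF that] by (auto simp: nbrs_def)
  \<comment> \<open>Two nonadjacent members of \<open>H\<close> share at most one neighbour, so
    \<open>K\<close> would contain them and five further vertices, too many. Adjacent ones have
    disjoint neighbourhoods of at least three vertices each, which fills all of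
    \<open>K\<close>.\<close>
  have adj: "X \<inter> Y = {}" "card K = 6" if "X \<in> H" "Y \<in> H" "X \<noteq> Y" for X Y
  proof -
    have XY: "X \<in> VV" "Y \<in> VV" "X \<in> K" "Y \<in> K" "card (nbrs K X) \<ge> 3" "card (nbrs K Y) \<ge> 3"
      using that K by (auto simp: H_def)
    have sub: "nbrs K X \<union> nbrs K Y \<subseteq> K" by (auto simp: nbrs_def)
    show disj: "X \<inter> Y = {}"
    proof (rule ccontr)
      assume "X \<inter> Y \<noteq> {}"
      then have "nbrs K X \<union> nbrs K Y \<subseteq> K - {X, Y}"
        using XY self[of X] self[of Y] sub by (auto simp: nbrs_def)
      then have "card (nbrs K X \<union> nbrs K Y) \<le> card (K - {X, Y})" using fK by (intro card_mono) auto
      also have "\<dots> = card K - 2" using XY that fK by (simp add: card_Diff_subset)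
      finally show False using card_nbrs_Un[OF K XY(1,2) that(3)] XY m by simp
    qed
    have "nbrs K X \<inter> nbrs K Y = {}" using nbrs_VV_disjoint[OF XY(1,2) disj] nbrs_mono[OF K] by blast
    then have "card (nbrs K X \<union> nbrs K Y) \<ge> 6"
      using XY finite_nbrs[OF K] by (simp add: card_Un_disjoint)
    then show "card K = 6" using card_mono[OF fK sub] m by simp
  qed
  \<comment> \<open>Three members of \<open>H\<close> would form a triangle.\<close>
  have H2: "card H \<le> 2"
  proof (rule ccontr)
    assume "\<not> card H \<le> 2"
    then have "3 \<le> card H" by simp
    then obtain T where "T \<subseteq> H" "card T = 3" by (meson obtain_subset_with_card_n)
    then obtain X Y Z where "X \<in> H" "Y \<in> H" "Z \<in> H" "X \<noteq> Y" "X \<noteq> Z" "Y \<noteq> Z"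
      by (auto simp: card_3_iff)
    then have "X \<in> VV" "Y \<in> VV" "X \<inter> Y = {}" "Z \<in> nbrs VV X \<inter> nbrs VV Y"
      using adj(1) HK K by (auto simp: nbrs_def)
    then show False using nbrs_VV_disjoint by blast
  qed
  have low: "9 * card L \<le> (\<Sum>X\<in>K. (card (nbrs (VV - K) X))\<^sup>2)" if "L \<subseteq> K - H" for L
  proof -
    have "9 \<le> (card (nbrs (VV - K) X))\<^sup>2" if "X \<in> L" for X
    proof -
      have "X \<in> VV" "card (nbrs K X) < 3" using that \<open>L \<subseteq> K - H\<close> K by (auto simp: H_def)
      then have "3 \<le> card (nbrs (VV - K) X)" using card_nbrs_split[OF K, of X] by linarith
      from power_mono[OF this, of 2] show ?thesis by simp
    qed
    then have "(\<Sum>X\<in>L. 9) \<le> (\<Sum>X\<in>L. (card (nbrs (VV - K) X))\<^sup>2)" by (rule sum_mono)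
    also have "\<dots> \<le> (\<Sum>X\<in>K. (card (nbrs (VV - K) X))\<^sup>2)"
      using that fK by (intro sum_mono2) auto
    finally show ?thesis by simp
  qed
  have cKH: "card (K - H) = card K - card H" using HK by (simp add: card_Diff_subset)
  show ?thesis
  proof (cases "card K = 2")
    case True
    \<comment> \<open>With two vertices the bound 9 per vertex is too weak, but each has at most one
      neighbour in \<open>K\<close> and contributes at least 16.\<close>
    have "16 \<le> (card (nbrs (VV - K) X))\<^sup>2" if "X \<in> K" for X
    proof -
      have "nbrs K X \<subseteq> K - {X}" using self[of X] that K by (auto simp: nbrs_def)
      then have "card (nbrs K X) \<le> 1" using card_mono[of "K - {X}" "nbrs K X"] fK that True by simp
      then have "4 \<le> card (nbrs (VV - K) X)" using card_nbrs_split[OF K, of X] that K by auto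
      from power_mono[OF this, of 2] show ?thesis by simp
    qed
    then have "(\<Sum>X\<in>K. 16) \<le> (\<Sum>X\<in>K. (card (nbrs (VV - K) X))\<^sup>2)" by (rule sum_mono)
    then show ?thesis using True by simp
  next
    case False
    \<comment> \<open>A single member of \<open>H\<close> already has three neighbours outside
      \<open>H\<close>; two members force \<open>card K = 6\<close> and leave four vertices. Three
      vertices outside \<open>H\<close> contribute 27.\<close>
    have "card (K - H) \<ge> 3"
    proof -
      consider "card H = 0" | "card H = 1" | "card H = 2" using H2 by linarith
      then show ?thesis
      proof cases
        case 1
        then show ?thesis using cKH m False by simp
      next
        case 2
        then obtain X where X: "X \<in> H" by fastforce
        then have "nbrs K X \<subseteq> K - {X}" using self[of X] HK K by (auto simp: nbrs_def)
        then have "card (nbrs K X) \<le> card K - 1" using card_mono[of "K - {X}" "nbrs K X"] fK X HK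
          by (auto simp: card_Diff_singleton)
        moreover have "card (nbrs K X) \<ge> 3" using X by (simp add: H_def)
        ultimately show ?thesis using cKH 2 by simp
      next
        case 3
        then obtain X Y where "X \<in> H" "Y \<in> H" "X \<noteq> Y" by (auto simp: card_2_iff)
        then show ?thesis using adj(2) cKH 3 by simp
      qed
    qed
    then show ?thesis using low[of "K - H"] by simp
  qed
qed

lemma boundary_squares_singleton:
  assumes "K \<subseteq> VV" "card K = 1"
  shows "(\<Sum>X\<in>K. (card (nbrs (VV - K) X))\<^sup>2) = 25"
proof -
  obtain X where X: "K = {X}" using assms by (auto simp: card_1_singleton_iff)
  then have "nbrs K X = {}" using assms VV_facts[of X] by (auto simp: nbrs_def)
  then have "card (nbrs (VV - K) X) = 5" using card_nbrs_split[OF assms(1), of X] assms X by simp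
  then show ?thesis using X by simp
qed

section \<open>Components of a vertex cut\<close>

lemma component_facts:
  assumes sym: "symp E" and K: "K \<in> components W E"
  shows component_subset: "K \<subseteq> W"
    and component_nonempty: "K \<noteq> {}"
    and component_closed: "\<And>x y. x \<in> K \<Longrightarrow> y \<in> W \<Longrightarrow> E x y \<Longrightarrow> y \<in> K"
    and component_disjoint: "\<And>L. L \<in> components W E \<Longrightarrow> K \<noteq> L \<Longrightarrow> K \<inter> L = {}"
proof -
  let ?R = "(induced_edges W E)\<^sup>*"
  have "sym (induced_edges W E)" using sympD[OF sym] by (auto simp: sym_def induced_edges_def)
  then have symR: "sym ?R" by (rule sym_rtrancl)
  obtain a where a: "a \<in> W" "K = {y \<in> W. (a, y) \<in> ?R}" using K by (auto simp: components_def)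
  show "K \<subseteq> W" "K \<noteq> {}" using a by auto
  show "y \<in> K" if "x \<in> K" "y \<in> W" "E x y" for x y
  proof -
    have "(x, y) \<in> induced_edges W E" using that a by (auto simp: induced_edges_def)
    then show ?thesis using that a by (auto intro: rtrancl_into_rtrancl)
  qed
  show "K \<inter> L = {}" if L: "L \<in> components W E" and "K \<noteq> L" for L
  proof (rule ccontr)
    assume "K \<inter> L \<noteq> {}"
    then obtain z where z: "z \<in> K" "z \<in> L" by blast
    obtain b where b: "b \<in> W" "L = {y \<in> W. (b, y) \<in> ?R}" using L by (auto simp: components_def)
    have "(a, z) \<in> ?R" "(b, z) \<in> ?R" using a b z by auto
    then have "(a, b) \<in> ?R" "(b, a) \<in> ?R" using symR by (meson rtrancl_trans symD)+
    then have "K = L" using a b by (auto intro: rtrancl_trans)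
    with \<open>K \<noteq> L\<close> show False ..
  qed
qed

lemma Union_components: "\<Union> (components W E) = W"
  by (auto simp: components_def)

lemma symp_kneser_adj: "symp kneser_adj"
  by (auto simp: symp_def kneser_adj_def)

lemmas kneser_component = component_facts[OF symp_kneser_adj]

text \<open>No edge joins two different components, so every edge leaving \<open>K\<close> ends in
  \<open>S\<close>. This turns boundary degrees of components into neighbour counts in
  \<open>S\<close>.\<close>

lemma component_boundary:
  assumes "K \<in> components (VV - S) kneser_adj" "X \<in> K" "S \<subseteq> VV"
  shows "nbrs (VV - K) X = nbrs S X"
  using kneser_component(1,3)[OF assms(1)] assms(2,3) by (auto simp: nbrs_def kneser_adj_def)

text \<open>Outside \<open>K\<close> there are at most 14 vertices, split into \<open>S\<close> and
  the remaining components \<open>T\<close>, and every neighbour of a vertex of \<open>T\<close>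
  lies among them. This room allows at most two components besides \<open>K\<close> and forces
  \<open>S\<close> to be large enough.\<close>

lemma cut_with_huge_component:
  assumes S: "S \<subseteq> VV" and c: "card (components (VV - S) kneser_adj) \<ge> 2"
    and K: "K \<in> components (VV - S) kneser_adj" "card K \<ge> 112"
  shows "5 * card (components (VV - S) kneser_adj) < 4 * card S"
proof -
  define C where "C = components (VV - S) kneser_adj"
  define U where "U = VV - K"
  define T where "T = VV - S - K"
  note KC = kneser_component[OF K(1)]
  have KV: "K \<subseteq> VV" using KC(1) by auto
  have fU: "finite U" "S \<subseteq> U" "T \<subseteq> U" "U = S \<union> T" "S \<inter> T = {}" using KC(1) S by (auto simp: U_def T_def)
  have cU: "card U \<le> 14" using K(2) KV by (simp add: U_def card_Diff_subset finite_subset)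
  have TV: "T \<subseteq> VV" by (auto simp: T_def)
  have N: "nbrs VV t \<subseteq> U" if t: "t \<in> T" for t
  proof
    fix Z assume Z: "Z \<in> nbrs VV t"
    have "Z \<notin> K"
    proof
      assume "Z \<in> K"
      moreover have "kneser_adj Z t" using Z by (auto simp: nbrs_def kneser_adj_def)
      ultimately have "t \<in> K" using KC(3)[of Z t] t by (auto simp: T_def)
      then show False using t by (simp add: T_def)
    qed
    then show "Z \<in> U" using Z by (auto simp: nbrs_def U_def)
  qed
  \<comment> \<open>Three neighbours of \<open>t\<close> in \<open>T\<close> have at least 12
    neighbours together, all distinct from the five neighbours of \<open>t\<close> because there are
    no triangles; 17 vertices do not fit into \<open>U\<close>.\<close>
  have inS: "card (nbrs S t) \<ge> 3" if t: "t \<in> T" for t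
  proof -
    have tV: "t \<in> VV" using t TV by auto
    have "card (nbrs T t) \<le> 2"
    proof (rule ccontr)
      assume "\<not> card (nbrs T t) \<le> 2"
      then have "3 \<le> card (nbrs T t)" by simp
      then obtain R where "R \<subseteq> nbrs T t" "card R = 3" by (meson obtain_subset_with_card_n)
      then obtain x y z where xyz: "x \<in> nbrs T t" "y \<in> nbrs T t" "z \<in> nbrs T t" "x \<noteq> y" "x \<noteq> z" "y \<noteq> z"
        by (auto simp: card_3_iff)
      then have T3: "x \<in> T" "y \<in> T" "z \<in> T" by (auto simp: nbrs_def)
      let ?M = "nbrs VV x \<union> nbrs VV y \<union> nbrs VV z"
      have "nbrs VV t \<inter> ?M = {}"
      proof -
        have "nbrs VV t \<inter> nbrs VV w = {}" if "w \<in> nbrs T t" for w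
          using that TV tV nbrs_VV_disjoint[of t w] unfolding nbrs_def by blast
        then show ?thesis using xyz by blast
      qed
      then have "card (nbrs VV t \<union> ?M) = 5 + card ?M"
        using card_nbrs_VV[OF tV] finite_nbrs[of VV] by (simp add: card_Un_disjoint)
      moreover have "12 \<le> card ?M" using card_nbrs_Un3[of x y z] xyz T3 TV by auto
      moreover have "card (nbrs VV t \<union> ?M) \<le> card U"
        using N[OF t] N[OF T3(1)] N[OF T3(2)] N[OF T3(3)] fU(1) by (intro card_mono) auto
      ultimately show False using cU by simp
    qed
    moreover have "nbrs VV t = nbrs S t \<union> nbrs T t" using N[OF t] fU S TV by (auto simp: nbrs_def)
    then have "card (nbrs VV t) \<le> card (nbrs S t) + card (nbrs T t)" by (simp add: card_Un_le)
    ultimately show ?thesis using card_nbrs_VV[OF tV] by simp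
  qed
  have CK: "card (C - {K}) = card C - 1" using K(1) by (simp add: C_def)
  have rep: "\<exists>x. x \<in> A \<and> x \<in> T" if "A \<in> C - {K}" for A
  proof -
    have "A \<subseteq> VV - S" "A \<noteq> {}" "K \<inter> A = {}"
      using that kneser_component(1,2)[of A "VV - S"] kneser_component(4)[OF K(1), of A]
      by (auto simp: C_def)
    then show ?thesis unfolding T_def by blast
  qed
  have sep: "x \<noteq> y \<and> x \<inter> y \<noteq> {}" if "A \<in> C" "B \<in> C" "A \<noteq> B" "x \<in> A" "y \<in> B" for A B x y
  proof -
    have "A \<inter> B = {}" using kneser_component(4)[of A "VV - S" B] that by (simp add: C_def)
    moreover have "y \<in> VV - S" using kneser_component(1)[of B "VV - S"] that by (auto simp: C_def)
    ultimately show ?thesis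
      using kneser_component(3)[of A "VV - S" x y] that unfolding C_def kneser_adj_def by blast
  qed
  \<comment> \<open>Representatives of three further components are pairwise nonadjacent, so they
    and their at least 12 neighbours would be 15 vertices of \<open>U\<close>.\<close>
  have c3: "card C \<le> 3"
  proof (rule ccontr)
    assume "\<not> card C \<le> 3"
    then have "3 \<le> card (C - {K})" using CK by simp
    then obtain R where "R \<subseteq> C - {K}" "card R = 3" by (meson obtain_subset_with_card_n)
    then obtain A B D where ABD: "A \<in> C - {K}" "B \<in> C - {K}" "D \<in> C - {K}" "A \<noteq> B" "A \<noteq> D" "B \<noteq> D"
      by (auto simp: card_3_iff)
    obtain x y z where xyz: "x \<in> A" "x \<in> T" "y \<in> B" "y \<in> T" "z \<in> D" "z \<in> T"
      using rep ABD by meson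
    have xy: "x \<noteq> y \<and> x \<inter> y \<noteq> {}" using sep[of A B x y] ABD xyz by auto
    have xz: "x \<noteq> z \<and> x \<inter> z \<noteq> {}" using sep[of A D x z] ABD xyz by auto
    have yz: "y \<noteq> z \<and> y \<inter> z \<noteq> {}" using sep[of B D y z] ABD xyz by auto
    have ne: "x \<noteq> {}" "y \<noteq> {}" "z \<noteq> {}" using xy xz by auto
    let ?M = "nbrs VV x \<union> nbrs VV y \<union> nbrs VV z"
    have "{x, y, z} \<inter> ?M = {}" using xy xz yz ne by (auto simp: nbrs_def)
    then have "card ({x, y, z} \<union> ?M) = card {x, y, z} + card ?M"
      using finite_nbrs[of VV] by (intro card_Un_disjoint) auto
    moreover have "card {x, y, z} = 3" using xy xz yz by simp
    moreover have "12 \<le> card ?M" using card_nbrs_Un3[of x y z] xyz xy xz yz TV by auto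
    moreover have "card ({x, y, z} \<union> ?M) \<le> card U"
      using N[OF xyz(2)] N[OF xyz(4)] N[OF xyz(6)] xyz fU by (intro card_mono) auto
    ultimately show False using cU by simp
  qed
  have nS: "nbrs S t \<subseteq> S" for t by (auto simp: nbrs_def)
  have fS: "finite S" using S by (rule finite_subset) simp
  have "card C \<ge> 2" using c by (simp add: C_def)
  with c3 consider "card C = 2" | "card C = 3" by linarith
  then have "5 * card C < 4 * card S"
  proof cases
    case 1
    then have "card (C - {K}) = 1" using CK by simp
    then obtain A where "A \<in> C - {K}" by (metis card_1_singletonE insertI1)
    then obtain x where "x \<in> T" using rep by blast
    then have "3 \<le> card S" using inS[of x] card_mono[OF fS nS[of x]] by simp
    then show ?thesis using 1 by simp
  next
    case 2
    then have "card (C - {K}) = 2" using CK by simp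
    then obtain A B where AB: "A \<in> C - {K}" "B \<in> C - {K}" "A \<noteq> B" by (auto simp: card_2_iff)
    obtain x y where xy: "x \<in> A" "x \<in> T" "y \<in> B" "y \<in> T" using rep AB by meson
    have "x \<noteq> y" using sep[of A B x y] AB xy by auto
    \<comment> \<open>At least three neighbours each and at most one in common give
      \<open>card S \<ge> 5\<close>, and 15 < 20.\<close>
    then have "card (nbrs S x) + card (nbrs S y) \<le> card (nbrs S x \<union> nbrs S y) + 1"
      using card_nbrs_Un[OF S, of x y] xy TV by auto
    moreover have "card (nbrs S x \<union> nbrs S y) \<le> card S" using nS fS by (intro card_mono) auto
    ultimately show ?thesis using inS[of x] inS[of y] xy 2 by simp
  qed
  then show ?thesis by (simp add: C_def)
qed

text \<open>The sums \<open>g K\<close> add up to the sum of squared neighbour counts outside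
  \<open>S\<close>, so 25 per component is compared with \<open>20 * card S\<close>. In the equality
  case no component may exceed 25, which leaves only single vertices.\<close>

lemma cut_ratio:
  assumes S: "S \<subseteq> VV" and c: "card (components (VV - S) kneser_adj) \<ge> 2"
  shows "5 * card (components (VV - S) kneser_adj) \<le> 4 * card S"
    and "5 * card (components (VV - S) kneser_adj) = 4 * card S \<Longrightarrow>
      \<forall>K\<in>components (VV - S) kneser_adj. card K = 1"
proof -
  define C where "C = components (VV - S) kneser_adj"
  define g where "g K = (\<Sum>X\<in>K. (card (nbrs (VV - K) X))\<^sup>2)" for K
  have "5 * card C \<le> 4 * card S \<and> (5 * card C = 4 * card S \<longrightarrow> (\<forall>K\<in>C. card K = 1))"
  proof (cases "\<exists>K\<in>C. card K \<ge> 112")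
    case True
    then obtain K where "K \<in> C" "112 \<le> card K" by blast
    then have "5 * card C < 4 * card S" using cut_with_huge_component[OF S c] by (simp add: C_def)
    then show ?thesis by simp
  next
    case False
    have finC: "finite C" unfolding C_def components_def by simp
    have finK: "finite K" if "K \<in> C" for K
      using kneser_component(1)[of K "VV - S"] that finite_subset[of K VV] by (auto simp: C_def)
    have g1: "g K = 25" if "K \<in> C" "card K = 1" for K
      using boundary_squares_singleton[of K] kneser_component(1)[of K "VV - S"] that by (auto simp: C_def g_def)
    have g2: "25 < g K" if "K \<in> C" "card K \<noteq> 1" for K
    proof -
      have KV: "K \<subseteq> VV" using kneser_component(1)[of K "VV - S"] that(1) by (auto simp: C_def)
      have "card K \<noteq> 0" using kneser_component(2)[of K "VV - S"] finK that(1) by (auto simp: C_def)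
      moreover have "card K < 112" using that(1) False by (meson not_le)
      ultimately have "2 \<le> card K \<and> card K \<le> 6 \<or> 7 \<le> card K \<and> card K \<le> 111"
        using that(2) by linarith
      then show ?thesis
        using boundary_squares_small[OF KV] boundary_squares_large[OF KV] unfolding g_def by blast
    qed
    have g25: "25 \<le> g K" if "K \<in> C" for K using g1[OF that] g2[OF that] by (cases "card K = 1") auto
    have "(\<Sum>K\<in>C. g K) = (\<Sum>K\<in>C. \<Sum>X\<in>K. (card (nbrs S X))\<^sup>2)"
    proof (rule sum.cong[OF refl])
      fix K assume "K \<in> C"
      then show "g K = (\<Sum>X\<in>K. (card (nbrs S X))\<^sup>2)"
        unfolding g_def C_def by (intro sum.cong refl) (simp only: component_boundary[OF _ _ S])
    qed
    also have "\<dots> = (\<Sum>X\<in>\<Union> C. (card (nbrs S X))\<^sup>2)"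
    proof -
      have "\<forall>K\<in>C. \<forall>L\<in>C. K \<noteq> L \<longrightarrow> K \<inter> L = {}"
        unfolding C_def using kneser_component(4) by blast
      then show ?thesis using finK sum.Union_disjoint[of C "\<lambda>X. (card (nbrs S X))\<^sup>2"] by (simp add: comp_def)
    qed
    also have "\<Union> C = VV - S" unfolding C_def by (rule Union_components)
    finally have tot: "(\<Sum>K\<in>C. g K) \<le> 20 * card S" using sum_nbrs_squared_outside[OF S] by simp
    have low: "25 * card C \<le> (\<Sum>K\<in>C. g K)" using sum_mono[of C "\<lambda>_. 25" g] g25 by simp
    have "card K = 1" if eq: "5 * card C = 4 * card S" and K: "K \<in> C" for K
    proof (rule ccontr)
      assume "card K \<noteq> 1"
      then have "(\<Sum>K\<in>C. 25) < (\<Sum>K\<in>C. g K)"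
        using finC g25 g2[OF K] K by (intro sum_strict_mono_ex1) auto
      then show False using tot eq by simp
    qed
    moreover have "5 * card C \<le> 4 * card S" using tot low by linarith
    ultimately show ?thesis by blast
  qed
  then show "5 * card (components (VV - S) kneser_adj) \<le> 4 * card S"
    "5 * card (components (VV - S) kneser_adj) = 4 * card S \<Longrightarrow>
      \<forall>K\<in>components (VV - S) kneser_adj. card K = 1"
    unfolding C_def by blast+
qed

section \<open>Maximum independent sets\<close>

lemma independent_card:
  assumes "independent_set VV kneser_adj J"
  shows "card J \<le> 56"
proof -
  have J: "J \<subseteq> VV" "\<And>X Y. X \<in> J \<Longrightarrow> Y \<in> J \<Longrightarrow> X \<inter> Y \<noteq> {}"
    using assms by (auto simp: independent_set_def kneser_adj_def)
  have "nbrs J X = {}" if "X \<in> J" for X using J that by (auto simp: nbrs_def)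
  then have "card (nbrs (VV - J) X) = 5" if "X \<in> J" for X
    using card_nbrs_split[OF J(1), of X] J(1) that by auto
  moreover have "VV - (VV - J) = J" using J by auto
  \<comment> \<open>Every vertex of \<open>J\<close> has all five neighbours outside
    \<open>J\<close>, so the bound for squares applies to the complement of \<open>J\<close>; it
    gives \<open>45 * card J \<le> 2520\<close>.\<close>
  ultimately have "25 * card J \<le> 20 * card (VV - J)"
    using sum_nbrs_squared_outside[of "VV - J"] by simp
  moreover have "card (VV - J) = 126 - card J" using J by (simp add: card_Diff_subset finite_subset)
  ultimately show ?thesis by simp
qed

lemma independent_components:
  assumes "independent_set VV kneser_adj I"
  shows "components I kneser_adj = (\<lambda>X. {X}) ` I"
proof -
  have "induced_edges I kneser_adj = {}"
    using assms by (auto simp: independent_set_def induced_edges_def)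
  then show ?thesis unfolding components_def by (auto intro!: image_cong)
qed

lemma singleton_components_independent:
  assumes "W \<subseteq> VV" "\<forall>K\<in>components W kneser_adj. card K = 1"
  shows "independent_set VV kneser_adj W"
  unfolding independent_set_def
proof (intro conjI ballI notI)
  fix X Y assume XY: "X \<in> W" "Y \<in> W" "kneser_adj X Y"
  obtain K where K: "K \<in> components W kneser_adj" "X \<in> K"
    using XY(1) Union_components[of W kneser_adj] by auto
  then have "Y \<in> K" using kneser_component(3)[OF K(1)] XY by simp
  moreover obtain Z where "K = {Z}" using assms(2) K(1) by (meson card_1_singletonE)
  ultimately have "X = Y" using K(2) by simp
  then show False using XY assms(1) VV_facts[of X] by (auto simp: kneser_adj_def)
qed (rule assms)

text \<open>The 4-sets through a fixed point attain the bound 56: removing the point leaves an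
  arbitrary 3-subset of the other eight points.\<close>

lemma star_independent:
  defines "I \<equiv> {X \<in> VV. 1 \<in> X}"
  shows "independent_set VV kneser_adj I" "card I = 56"
proof -
  show "independent_set VV kneser_adj I" by (auto simp: I_def independent_set_def kneser_adj_def)
  have "I = insert 1 ` {B. B \<subseteq> {2..9} \<and> card B = 3}"
  proof (intro equalityI subsetI)
    fix X assume "X \<in> I"
    then have X: "X \<subseteq> {1..9}" "card X = 4" "finite X" "1 \<in> X" using VV_facts[of X] by (auto simp: I_def)
    have "X - {1} \<subseteq> {2..9}" using X(1) by (force simp: subset_eq)
    then have "X - {1} \<in> {B. B \<subseteq> {2..9} \<and> card B = 3}" using X by simp
    moreover have "X = insert 1 (X - {1})" using X by auto
    ultimately show "X \<in> insert 1 ` {B. B \<subseteq> {2..9} \<and> card B = 3}" by blast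
  next
    fix X assume "X \<in> insert 1 ` {B. B \<subseteq> {2..9::nat} \<and> card B = 3}"
    then obtain B where B: "B \<subseteq> {2..9}" "card B = 3" "X = insert 1 B" by auto
    moreover have "finite B" "1 \<notin> B" using B finite_subset by auto
    ultimately show "X \<in> I" by (force simp: I_def kneser_vertices_def)
  qed
  moreover have "inj_on (insert (1::nat)) {B. B \<subseteq> {2..9} \<and> card B = 3}"
  proof (rule inj_onI)
    fix A B :: "nat set"
    assume "A \<in> {B. B \<subseteq> {2..9} \<and> card B = 3}" "B \<in> {B. B \<subseteq> {2..9} \<and> card B = 3}"
    then have "1 \<notin> A" "1 \<notin> B" by auto
    moreover assume "insert 1 A = insert 1 B"
    ultimately show "A = B" by (rule insert_ident[THEN iffD1])
  qed
  ultimately have "card I = card {B. B \<subseteq> {2..9::nat} \<and> card B = 3}" by (simp add: card_image)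
  also have "\<dots> = 56" by (simp add: n_subsets numeral_eq_Suc)
  finally show "card I = 56" .
qed

theorem theorem5p5:
  shows "toughness (kneser_vertices 9 4) kneser_adj = 5 / 4
    \<and> (\<forall>S. is_vertex_cut (kneser_vertices 9 4) kneser_adj S \<and>
          real (card S) / real (num_components (kneser_vertices 9 4) kneser_adj S) = 5 / 4
        \<longrightarrow> (\<exists>I. maximum_independent_set (kneser_vertices 9 4) kneser_adj I
                 \<and> S = kneser_vertices 9 4 - I))"
proof (intro conjI allI impI)
  define I where "I = {X \<in> VV. 1 \<in> X}"
  have I: "independent_set VV kneser_adj I" "card I = 56"
    unfolding I_def by (rule star_independent)+
  have IV: "I \<subseteq> VV" by (auto simp: I_def)
  \<comment> \<open>Deleting the complement of the star leaves 56 isolated vertices, so this cut has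
    ratio 70/56 = 5/4 and the infimum is attained.\<close>
  have "card (VV - I) = 70" using IV I by (simp add: card_Diff_subset finite_subset)
  moreover have "VV - (VV - I) = I" using IV by auto
  then have nI: "num_components VV kneser_adj (VV - I) = 56"
    using I by (simp add: num_components_def independent_components card_image)
  moreover have "is_vertex_cut VV kneser_adj (VV - I)" using nI by (simp add: is_vertex_cut_def)
  ultimately have "5 / 4 \<in> (\<lambda>S. real (card S) / real (num_components VV kneser_adj S)) ` {S. is_vertex_cut VV kneser_adj S}"
    by (intro image_eqI[where x = "VV - I"]) auto
  moreover have "5 / 4 \<le> real (card S) / real (num_components VV kneser_adj S)" if "is_vertex_cut VV kneser_adj S" for S
  proof -
    have "5 * num_components VV kneser_adj S \<le> 4 * card S" "num_components VV kneser_adj S \<ge> 2"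
      using cut_ratio(1)[of S] that by (auto simp: is_vertex_cut_def num_components_def)
    then show ?thesis by (simp add: field_simps)
  qed
  ultimately show "toughness VV kneser_adj = 5 / 4"
    unfolding toughness_def by (intro cInf_eq_minimum) auto
next
  fix S assume cut: "is_vertex_cut VV kneser_adj S \<and> real (card S) / real (num_components VV kneser_adj S) = 5 / 4"
  let ?I = "VV - S"
  have S: "S \<subseteq> VV" and c: "card (components ?I kneser_adj) \<ge> 2"
    using cut by (auto simp: is_vertex_cut_def num_components_def)
  have eq: "5 * card (components ?I kneser_adj) = 4 * card S"
    using cut c by (simp add: num_components_def field_simps)
  have ind: "independent_set VV kneser_adj ?I"
    using cut_ratio(2)[OF S c eq] by (intro singleton_components_independent) auto
  have "card (components ?I kneser_adj) = card ?I"
    using ind by (simp add: independent_components card_image)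
  moreover have "card ?I = 126 - card S" "card S \<le> 126"
    using S card_mono[OF finite_VV S] by (simp_all add: card_Diff_subset finite_subset)
  \<comment> \<open>All components are single vertices, so
    \<open>5 * (126 - card S) = 4 * card S\<close>, hence \<open>card S = 70\<close>.\<close>
  ultimately have "card ?I = 56" using eq by linarith
  then have "maximum_independent_set VV kneser_adj ?I"
    using ind independent_card by (simp add: maximum_independent_set_def)
  moreover have "S = VV - ?I" using S by auto
  ultimately show "\<exists>I. maximum_independent_set VV kneser_adj I \<and> S = VV - I" by blast
qed

end
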